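(* Let $a,b\in\mathbb{N}$ with $a\le b$. If $a+b$ is odd, then $\mathcal{C}_1(a,b)=\mathcal{C}_0(a,b)$.
   Context: $\mathbb{N}$ denotes the positive integers. For $a,b\in\mathbb{N}$ with $a\le b$, let $\mathcal{V}=\operatorname{Mat}(a,b,\mathbb{F}_2)$ be the $\mathbb{F}_2$-vector space of $a\times b$ matrices, with standard basis the elementary matrices $\mathbf{e}_{ij}$, $1\le i\le a$, $1\le j\le b$. Define $\mathbf{r}_i=\sum_{j=1}^b\mathbf{e}_{ij}$ ($1\le i\le a$) and $\mathbf{c}_j=\sum_{i=1}^a\mathbf{e}_{ij}$ ($1\le j\le b$). Let $\mathcal{C}_0(a,b)\le\mathcal{V}$ be the $\mathbb{F}_2$-span of $\{\mathbf{r}_1,\ldots,\mathbf{r}_a,\mathbf{c}_1,\ldots,\mathbf{c}_b\}$, and let $\mathcal{C}_1(a,b)\le\mathcal{V}$ be the $\mathbb{F}_2$-span of $\{\mathbf{r}_i+\mathbf{c}_j : 1\le i\le a,\ 1\le j\le b\}$. *)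

theory Defs
  imports "Jordan_Normal_Form.VS_Connect" "HOL-Library.Z2"
begin

text \<open>The field of two elements is the type \<open>bit\<close>. Indices are 0-based, as for
  \<^typ>\<open>'a mat\<close>: rows are \<open>i < a\<close> and columns are \<open>j < b\<close>.\<close>

abbreviation V :: "nat \<Rightarrow> nat \<Rightarrow> (bit, bit mat) module" where
  "V a b \<equiv> module_mat TYPE(bit) a b"

abbreviation span_F2 :: "nat \<Rightarrow> nat \<Rightarrow> bit mat set \<Rightarrow> bit mat set" where
  "span_F2 a b \<equiv> LinearCombinations.module.span class_ring (V a b)"

definition elem_mat :: "nat \<Rightarrow> nat \<Rightarrow> nat \<Rightarrow> nat \<Rightarrow> bit mat" where
  "elem_mat a b i j = mat a b (\<lambda>(k, l). if k = i \<and> l = j then 1 else 0)"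

definition row_mat :: "nat \<Rightarrow> nat \<Rightarrow> nat \<Rightarrow> bit mat" where
  "row_mat a b i = (\<Oplus>\<^bsub>V a b\<^esub>j\<in>{..<b}. elem_mat a b i j)"

definition col_mat :: "nat \<Rightarrow> nat \<Rightarrow> nat \<Rightarrow> bit mat" where
  "col_mat a b j = (\<Oplus>\<^bsub>V a b\<^esub>i\<in>{..<a}. elem_mat a b i j)"

definition C0 :: "nat \<Rightarrow> nat \<Rightarrow> bit mat set" where
  "C0 a b = span_F2 a b (row_mat a b ` {..<a} \<union> col_mat a b ` {..<b})"

definition C1 :: "nat \<Rightarrow> nat \<Rightarrow> bit mat set" where
  "C1 a b = span_F2 a b {row_mat a b i + col_mat a b j | i j. i < a \<and> j < b}"

lemma elem_mat_carrier [simp]: "elem_mat a b i j \<in> carrier_mat a b"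
  by (simp add: elem_mat_def)

lemma finsum_V:
  assumes "finite S" "\<And>x. x \<in> S \<Longrightarrow> f x \<in> carrier_mat a b"
  shows "finsum (V a b) f S = mat a b (\<lambda>(k, l). \<Sum>x\<in>S. f x $$ (k, l))"
proof -
  interpret abelian_group "V a b" by (rule abelian_group_mat)
  show ?thesis
    using assms
  proof (induction S rule: finite_induct)
    case empty
    show ?case by (auto simp: module_mat_simps)
  next
    case (insert x S)
    have "finsum (V a b) f (insert x S) = f x + finsum (V a b) f S"
      using insert by (subst finsum_insert) (auto simp: module_mat_simps)
    then show ?case using insert by auto
  qed
qed

lemma row_mat_eq: "row_mat a b i = mat a b (\<lambda>(k, l). if k = i then 1 else 0)"
  unfolding row_mat_def
  by (subst finsum_V) (auto simp: elem_mat_def if_distrib sum.delta' cong: if_cong)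

lemma col_mat_eq: "col_mat a b j = mat a b (\<lambda>(k, l). if l = j then 1 else 0)"
  unfolding col_mat_def
  by (subst finsum_V) (auto simp: elem_mat_def if_distrib sum.delta' cong: if_cong)

end

theory Submission
  imports Defs
begin

text \<open>
  Adding all generators \<open>r\<^sub>i + c\<^sub>j\<close> of \<open>C1\<close>, each row \<open>r\<^sub>i\<close> is counted \<open>b\<close> times and each
  column \<open>c\<^sub>j\<close> is counted \<open>a\<close> times. The rows add up to the all-ones matrix \<open>J\<close>, and so do the
  columns, so the total is \<open>(a + b) J\<close>, which is \<open>J\<close> when \<open>a + b\<close> is odd; hence \<open>J\<close> lies in \<open>C1\<close>.
  One of \<open>a\<close>, \<open>b\<close> is odd. If \<open>a\<close> is, then \<open>\<Sum>\<^sub>i (r\<^sub>i + c\<^sub>j) = J + a c\<^sub>j = J + c\<^sub>j\<close>, so every \<open>c\<^sub>j\<close>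
  lies in \<open>C1\<close>, and therefore so does every \<open>r\<^sub>i = (r\<^sub>i + c\<^sub>j) + c\<^sub>j\<close>. If \<open>b\<close> is odd, the same
  argument with \<open>\<Sum>\<^sub>j (r\<^sub>i + c\<^sub>j) = J + r\<^sub>i\<close> starts from the rows. This gives
  \<open>C0 \<subseteq> C1\<close> (\<open>row_and_col_mat_in_C1\<close>); the other inclusion is immediate.
\<close>

text \<open>The arguments below are arithmetic in a field of characteristic two, so \<open>+\<close> and \<open>*\<close> on
  \<open>bit\<close> are kept as ring operations instead of being rewritten to bitwise connectives.\<close>

declare add_bit_eq_xor [simp del] mult_bit_eq_and [simp del]

lemma submodule_span_F2:
  assumes "S \<subseteq> carrier_mat a b"
  shows "submodule class_ring (span_F2 a b S) (V a b)"
proof -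
  interpret VectorSpace.vectorspace class_ring "V a b"
    by (rule matrix_vs)
  show ?thesis
    using assms by (intro span_is_submodule) (simp add: module_mat_simps)
qed

lemma span_F2_superset:
  assumes "S \<subseteq> carrier_mat a b"
  shows "S \<subseteq> span_F2 a b S"
proof -
  interpret VectorSpace.vectorspace class_ring "V a b"
    by (rule matrix_vs)
  show ?thesis
    using assms by (intro in_own_span) (simp add: module_mat_simps)
qed

lemma span_F2_minimal:
  assumes "S \<subseteq> N" "submodule class_ring N (V a b)"
  shows "span_F2 a b S \<subseteq> N"
proof -
  interpret VectorSpace.vectorspace class_ring "V a b"
    by (rule matrix_vs)
  show ?thesis
    using assms by (intro span_is_subset)
qed

lemma span_F2_add:
  assumes "S \<subseteq> carrier_mat a b" "x \<in> span_F2 a b S" "y \<in> span_F2 a b S"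
  shows "x + y \<in> span_F2 a b S"
  using submodule.m_closed[OF submodule_span_F2[OF assms(1)] assms(2,3)]
  by (simp add: module_mat_simps)

lemma span_F2_sum:
  assumes "S \<subseteq> carrier_mat a b" "finite X" "\<And>x. x \<in> X \<Longrightarrow> f x \<in> span_F2 a b S"
  shows "mat a b (\<lambda>(k, l). \<Sum>x\<in>X. f x $$ (k, l)) \<in> span_F2 a b S"
  using assms(2,3)
proof (induction X rule: finite_induct)
  case empty
  have "0\<^sub>m a b \<in> span_F2 a b S"
    using submodule.zero_closed[OF submodule_span_F2[OF assms(1)]]
    by (simp add: module_mat_simps)
  moreover have "mat a b (\<lambda>(k, l). \<Sum>x\<in>{}. f x $$ (k, l)) = 0\<^sub>m a b"
    by auto
  ultimately show ?case by metis
next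
  case (insert x X)
  have "f x \<in> carrier_mat a b"
    using insert.prems submodule.subset[OF submodule_span_F2[OF assms(1)]]
    by (auto simp: module_mat_simps)
  then have "mat a b (\<lambda>(k, l). \<Sum>y\<in>insert x X. f y $$ (k, l))
      = f x + mat a b (\<lambda>(k, l). \<Sum>y\<in>X. f y $$ (k, l))"
    using insert.hyps by auto
  moreover have "f x + mat a b (\<lambda>(k, l). \<Sum>y\<in>X. f y $$ (k, l)) \<in> span_F2 a b S"
    using insert.prems insert.IH by (intro span_F2_add[OF assms(1)]) blast+
  ultimately show ?case by metis
qed

lemma row_mat_carrier [simp]: "row_mat a b i \<in> carrier_mat a b"
  by (simp add: row_mat_eq)

lemma col_mat_carrier [simp]: "col_mat a b j \<in> carrier_mat a b"
  by (simp add: col_mat_eq)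

lemma dim_row_col_mat [simp]:
  "dim_row (row_mat a b i) = a" "dim_col (row_mat a b i) = b"
  "dim_row (col_mat a b j) = a" "dim_col (col_mat a b j) = b"
  by (simp_all add: row_mat_eq col_mat_eq)

lemma index_row_col_mat [simp]:
  assumes "k < a" "l < b"
  shows "row_mat a b i $$ (k, l) = (if k = i then 1 else 0)"
    and "col_mat a b j $$ (k, l) = (if l = j then 1 else 0)"
  using assms by (simp_all add: row_mat_eq col_mat_eq)

lemma of_nat_bit: "of_nat n = (if odd n then 1 else (0 :: bit))"
  by (induction n) auto

definition ones_mat :: "nat \<Rightarrow> nat \<Rightarrow> bit mat" where
  "ones_mat a b = mat a b (\<lambda>_. 1)"

lemma generators_C1_carrier:
  "{row_mat a b i + col_mat a b j | i j. i < a \<and> j < b} \<subseteq> carrier_mat a b"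
  by auto

lemma generators_C0_carrier:
  "row_mat a b ` {..<a} \<union> col_mat a b ` {..<b} \<subseteq> carrier_mat a b"
  by auto

lemmas C1_add = span_F2_add[OF generators_C1_carrier, folded C1_def]
lemmas C1_sum = span_F2_sum[OF generators_C1_carrier, folded C1_def]

lemma row_plus_col_in_C1:
  assumes "i < a" "j < b"
  shows "row_mat a b i + col_mat a b j \<in> C1 a b"
  using assms span_F2_superset[OF generators_C1_carrier] unfolding C1_def by blast

text \<open>In the sum of all generators, the entry at \<open>(k, l)\<close> receives \<open>b\<close> ones from the generators
  containing \<open>r\<^sub>k\<close> and \<open>a\<close> ones from those containing \<open>c\<^sub>l\<close>.\<close>

lemma ones_mat_in_C1:
  assumes "odd (a + b)"
  shows "ones_mat a b \<in> C1 a b"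
proof -
  let ?g = "\<lambda>(i, j). row_mat a b i + col_mat a b j"
  have "mat a b (\<lambda>(k, l). \<Sum>p\<in>{..<a} \<times> {..<b}. ?g p $$ (k, l)) \<in> C1 a b"
    by (rule C1_sum) (auto intro: row_plus_col_in_C1)
  moreover have "(\<Sum>p\<in>{..<a} \<times> {..<b}. ?g p $$ (k, l)) = 1" if "k < a" "l < b" for k l
  proof -
    have "(\<Sum>p\<in>{..<a} \<times> {..<b}. ?g p $$ (k, l))
        = (\<Sum>i<a. \<Sum>j<b. (row_mat a b i + col_mat a b j) $$ (k, l))"
      by (simp add: sum.cartesian_product case_prod_unfold)
    also have "\<dots> = of_nat b + of_nat a"
      using that by (simp add: sum.distrib flip: sum_distrib_left)
    also have "\<dots> = 1"
      using assms by (auto simp: of_nat_bit)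
    finally show ?thesis .
  qed
  ultimately show ?thesis
    by (auto simp: ones_mat_def cong: cong_mat)
qed

text \<open>Adding up an odd number of generators that share \<open>c\<^sub>j\<close> leaves \<open>J + c\<^sub>j\<close>, and \<open>J\<close> is
  already in the span.\<close>

lemma col_mat_in_C1:
  assumes "odd a" "even b" "j < b"
  shows "col_mat a b j \<in> C1 a b"
proof -
  have "mat a b (\<lambda>(k, l). \<Sum>i<a. (row_mat a b i + col_mat a b j) $$ (k, l)) \<in> C1 a b"
    using assms by (intro C1_sum) (auto intro: row_plus_col_in_C1)
  then have "ones_mat a b + mat a b (\<lambda>(k, l). \<Sum>i<a. (row_mat a b i + col_mat a b j) $$ (k, l))
      \<in> C1 a b"
    using assms by (intro C1_add ones_mat_in_C1) auto
  \<comment> \<open>The two copies of \<open>J\<close> cancel.\<close>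
  also have "ones_mat a b + mat a b (\<lambda>(k, l). \<Sum>i<a. (row_mat a b i + col_mat a b j) $$ (k, l))
      = col_mat a b j"
    using assms
    by (intro eq_matI) (auto simp: ones_mat_def sum.distrib of_nat_bit)
  finally show ?thesis .
qed

lemma row_mat_in_C1:
  assumes "even a" "odd b" "i < a"
  shows "row_mat a b i \<in> C1 a b"
proof -
  have "mat a b (\<lambda>(k, l). \<Sum>j<b. (row_mat a b i + col_mat a b j) $$ (k, l)) \<in> C1 a b"
    using assms by (intro C1_sum) (auto intro: row_plus_col_in_C1)
  then have "ones_mat a b + mat a b (\<lambda>(k, l). \<Sum>j<b. (row_mat a b i + col_mat a b j) $$ (k, l))
      \<in> C1 a b"
    using assms by (intro C1_add ones_mat_in_C1) auto
  \<comment> \<open>The two copies of \<open>J\<close> cancel.\<close>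
  also have "ones_mat a b + mat a b (\<lambda>(k, l). \<Sum>j<b. (row_mat a b i + col_mat a b j) $$ (k, l))
      = row_mat a b i"
    using assms
    by (intro eq_matI) (auto simp: ones_mat_def sum.distrib of_nat_bit)
  finally show ?thesis .
qed

text \<open>In characteristic two, adding the generator \<open>r\<^sub>i + c\<^sub>j\<close> exchanges \<open>r\<^sub>i\<close> and \<open>c\<^sub>j\<close>, so the
  family handled by the parity of \<open>a\<close> and \<open>b\<close> brings the other one into the span. Each vector
  needs a partner of the other kind for this, so row and column indices are treated together.\<close>

lemma row_and_col_mat_in_C1:
  assumes "odd (a + b)" "i < a" "j < b"
  shows "row_mat a b i \<in> C1 a b" "col_mat a b j \<in> C1 a b"
proof -
  have "row_mat a b i \<in> C1 a b \<and> col_mat a b j \<in> C1 a b"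
  proof (cases "odd a")
    case True
    then have c: "col_mat a b j \<in> C1 a b"
      using assms by (intro col_mat_in_C1) auto
    have "row_mat a b i = (row_mat a b i + col_mat a b j) + col_mat a b j"
      by (intro eq_matI) auto
    then show ?thesis
      using c C1_add[OF row_plus_col_in_C1[OF assms(2,3)] c] by simp
  next
    case False
    then have r: "row_mat a b i \<in> C1 a b"
      using assms by (intro row_mat_in_C1) auto
    have "col_mat a b j = row_mat a b i + (row_mat a b i + col_mat a b j)"
      by (intro eq_matI) auto
    then show ?thesis
      using r C1_add[OF r row_plus_col_in_C1[OF assms(2,3)]] by simp
  qed
  then show "row_mat a b i \<in> C1 a b" "col_mat a b j \<in> C1 a b" by auto
qed

theorem proposition4p1:
  fixes a b :: nat
  assumes "1 \<le> a" and "1 \<le> b" and "a \<le> b" and "odd (a + b)"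
  shows "C1 a b = C0 a b"
proof (rule subset_antisym)
  have gen: "row_mat a b i \<in> C0 a b" "col_mat a b j \<in> C0 a b" if "i < a" "j < b" for i j
    using that span_F2_superset[OF generators_C0_carrier] unfolding C0_def by blast+
  show "C1 a b \<subseteq> C0 a b"
    unfolding C1_def
  proof (rule span_F2_minimal)
    show "{row_mat a b i + col_mat a b j | i j. i < a \<and> j < b} \<subseteq> C0 a b"
      using gen span_F2_add[OF generators_C0_carrier] unfolding C0_def by auto
    show "submodule class_ring (C0 a b) (V a b)"
      unfolding C0_def by (rule submodule_span_F2[OF generators_C0_carrier])
  qed
  show "C0 a b \<subseteq> C1 a b"
    unfolding C0_def
  proof (rule span_F2_minimal)
    have "0 < a" "0 < b" using assms by auto
    then show "row_mat a b ` {..<a} \<union> col_mat a b ` {..<b} \<subseteq> C1 a b"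
      using row_and_col_mat_in_C1[OF assms(4)] by blast
    show "submodule class_ring (C1 a b) (V a b)"
      unfolding C1_def by (rule submodule_span_F2[OF generators_C1_carrier])
  qed
qed

end
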